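(* Let $n\ge 4$ be an integer and let $$S_{2^n}=\langle x,y\mid x^{2^{n-1}}=y^2=1,\ y^{-1}xy=x^{2^{n-2}-1}\rangle$$ be the quasi-dihedral group of order $2^n$. Then $$\operatorname{cdeg}(S_{2^n})=\frac{3\cdot 2^{n-3}+n}{3\cdot 2^{n-2}+n-1}.$$
   Context: For a finite group $G$, let $L(G)$ be the set of all subgroups of $G$ and $C(G)$ the set of all cyclic subgroups of $G$. The cyclicity degree of $G$ is $\operatorname{cdeg}(G)=|C(G)|/|L(G)|$. *)

theory Defs
  imports Complex_Main "HOL-Algebra.Elementary_Groups"
begin

section \<open>Cyclicity degree\<close>

definition subgroups_of :: "('a, 'b) monoid_scheme \<Rightarrow> 'a set set" where
  "subgroups_of G = {H. subgroup H G}"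

definition cyclic_subgroups_of :: "('a, 'b) monoid_scheme \<Rightarrow> 'a set set" where
  "cyclic_subgroups_of G = {H. subgroup H G \<and> cyclic_group (G\<lparr>carrier := H\<rparr>)}"

text \<open>Meaningful for finite groups only, since \<^const>\<open>card\<close> sends infinite sets to 0.\<close>

definition cdeg :: "('a, 'b) monoid_scheme \<Rightarrow> real" where
  "cdeg G = real (card (cyclic_subgroups_of G)) / real (card (subgroups_of G))"


section \<open>Groups given by generators and relations\<close>

text \<open>
  The generators are all elements of a type. A word is a list of generators and formal inverses
  of generators, and a relation \<open>l = r\<close> is the pair of words \<open>(l, r)\<close>. The presented group
  consists of the words modulo the least congruence that contains the given relations and
  makes each generator and its formal inverse cancel.
\<close>

datatype 'g letter = Gen 'g | Inv 'g

type_synonym 'g word = "'g letter list"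

inductive word_eq :: "('g word \<times> 'g word) set \<Rightarrow> 'g word \<Rightarrow> 'g word \<Rightarrow> bool"
  for R where
  refl: "word_eq R u u"
| sym: "word_eq R u v \<Longrightarrow> word_eq R v u"
| trans: "word_eq R u v \<Longrightarrow> word_eq R v w \<Longrightarrow> word_eq R u w"
| Gen_Inv: "word_eq R (u @ [Gen g, Inv g] @ v) (u @ v)"
| Inv_Gen: "word_eq R (u @ [Inv g, Gen g] @ v) (u @ v)"
| rel: "(l, r) \<in> R \<Longrightarrow> word_eq R (u @ l @ v) (u @ r @ v)"

definition word_rel :: "('g word \<times> 'g word) set \<Rightarrow> ('g word \<times> 'g word) set" where
  "word_rel R = {(u, v). word_eq R u v}"

definition presented_group :: "('g word \<times> 'g word) set \<Rightarrow> 'g word set monoid" where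
  "presented_group R =
     \<lparr>carrier = UNIV // word_rel R,
      mult = (\<lambda>A B. \<Union>u\<in>A. \<Union>v\<in>B. word_rel R `` {u @ v}),
      one = word_rel R `` {[]}\<rparr>"

lemma equiv_word_rel: "equiv UNIV (word_rel R)"
  by (intro equivI refl_onI symI transI) (auto simp: word_rel_def intro: word_eq.intros)

lemma word_eq_context: "word_eq R u v \<Longrightarrow> word_eq R (p @ u @ q) (p @ v @ q)"
proof (induction rule: word_eq.induct)
  case (Gen_Inv u g v)
  show ?case using word_eq.Gen_Inv[of R "p @ u" g "v @ q"] by simp
next
  case (Inv_Gen u g v)
  show ?case using word_eq.Inv_Gen[of R "p @ u" g "v @ q"] by simp
next
  case (rel l r u v)
  then show ?case using word_eq.rel[of l r R "p @ u" "v @ q"] by simp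
qed (blast intro: word_eq.intros)+

lemma word_eq_append:
  assumes "word_eq R u u'" "word_eq R v v'"
  shows "word_eq R (u @ v) (u' @ v')"
  using word_eq_context[OF assms(1), of "[]" v] word_eq_context[OF assms(2), of u' "[]"]
  by (auto intro: word_eq.trans)

lemma presented_group_mult_class:
  "word_rel R `` {u} \<otimes>\<^bsub>presented_group R\<^esub> word_rel R `` {v} = word_rel R `` {u @ v}"
  by (auto simp: presented_group_def word_rel_def
      intro: word_eq_append word_eq.trans word_eq.refl)

fun inv_letter :: "'g letter \<Rightarrow> 'g letter" where
  "inv_letter (Gen g) = Inv g"
| "inv_letter (Inv g) = Gen g"

lemma word_eq_cancel: "word_eq R (rev (map inv_letter w) @ w) []"
proof (induction w)
  case (Cons a w)
  have "word_eq R (rev (map inv_letter w) @ [inv_letter a, a] @ w) (rev (map inv_letter w) @ w)"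
    by (cases a) (auto intro: word_eq.Gen_Inv[simplified] word_eq.Inv_Gen[simplified])
  with Cons show ?case by (auto intro: word_eq.trans)
qed (simp add: word_eq.refl)

lemma word_rel_eq_iff: "word_rel R `` {u} = word_rel R `` {v} \<longleftrightarrow> word_eq R u v"
  using eq_equiv_class_iff[OF equiv_word_rel[of R], of u v] by (simp add: word_rel_def)

lemma carrier_presented_group: "carrier (presented_group R) = range (\<lambda>u. word_rel R `` {u})"
  by (auto simp: presented_group_def quotient_def)

lemma one_presented_group: "\<one>\<^bsub>presented_group R\<^esub> = word_rel R `` {[]}"
  by (simp add: presented_group_def)

lemma group_presented_group: "group (presented_group R)"
proof (rule groupI)
  fix A assume "A \<in> carrier (presented_group R)"
  then obtain u where "A = word_rel R `` {u}" by (auto simp: carrier_presented_group)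
  then have "word_rel R `` {rev (map inv_letter u)} \<otimes>\<^bsub>presented_group R\<^esub> A = \<one>\<^bsub>presented_group R\<^esub>"
    by (simp add: presented_group_mult_class one_presented_group word_rel_eq_iff word_eq_cancel)
  then show "\<exists>B\<in>carrier (presented_group R). B \<otimes>\<^bsub>presented_group R\<^esub> A = \<one>\<^bsub>presented_group R\<^esub>"
    by (auto simp: carrier_presented_group)
qed (auto simp: carrier_presented_group one_presented_group presented_group_mult_class)


section \<open>Quasi-dihedral groups\<close>

datatype xy = X | Y

text \<open>
  Intended for \<open>n \<ge> 4\<close> only; the relations are \<open>x ^ (2 ^ (n - 1)) = 1\<close>, \<open>y ^ 2 = 1\<close> and
  \<open>inverse y * x * y = x ^ (2 ^ (n - 2) - 1)\<close>.
\<close>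

definition quasidihedral :: "nat \<Rightarrow> xy word set monoid" where
  "quasidihedral n = presented_group
     {(replicate (2 ^ (n - 1)) (Gen X), []),
      (replicate 2 (Gen Y), []),
      ([Inv Y, Gen X, Gen Y], replicate (2 ^ (n - 2) - 1) (Gen X))}"

end

theory Submission
  imports Defs "HOL-Computational_Algebra.Primes"
begin

text \<open>
  Every element of the quasi-dihedral group is uniquely \<open>x ^ i\<close> or \<open>x ^ i * y\<close> with \<open>i\<close> taken
  modulo \<open>2 ^ (n - 1)\<close>; uniqueness is read off an action of words on \<open>int \<times> bool\<close>. A subgroup
  meets \<open>\<langle>x\<rangle>\<close> in \<open>\<langle>x ^ d\<rangle>\<close> with \<open>d = 2 ^ k\<close>, and its elements outside \<open>\<langle>x\<rangle>\<close>, if any, are the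
  \<open>x ^ i * y\<close> with \<open>i\<close> in one residue class \<open>r\<close> modulo \<open>d\<close>. Since
  \<open>(x ^ i * y) ^ 2 = x ^ (2 ^ (n - 2) * i)\<close>, the class \<open>r\<close> is arbitrary for \<open>d \<le> 2 ^ (n - 2)\<close> and
  even for \<open>d = 2 ^ (n - 1)\<close>. The cyclic ones among the latter kind are those of order 2
  (\<open>d = 2 ^ (n - 1)\<close>) and those of order 4 (\<open>d = 2 ^ (n - 2)\<close>, \<open>r\<close> odd).
\<close>

section \<open>Subgroups and cyclic subgroups\<close>

text \<open>Powers formed inside \<open>H\<close> agree with powers in \<open>G\<close>, so
  cyclicity can be tested without the restricted monoid.\<close>

lemma (in group) cyclic_subgroups_of_iff:
  "H \<in> cyclic_subgroups_of G \<longleftrightarrow> subgroup H G \<and> (\<exists>g\<in>H. H = range (\<lambda>k::int. g [^] k))"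
proof (cases "subgroup H G")
  case True
  interpret H: group "G\<lparr>carrier := H\<rparr>" using True by (rule subgroup_imp_group)
  show ?thesis
    using True int_pow_consistent[OF True]
    by (auto simp: cyclic_subgroups_of_def H.cyclic_group)
qed (simp add: cyclic_subgroups_of_def)

text \<open>Division with remainder by the least positive element, which \<open>m\<close> provides.
  It is applied to the exponents of the powers of \<open>x\<close> lying in a subgroup.\<close>

lemma int_subgroup_eq_multiples:
  fixes I :: "int set"
  assumes diff: "\<And>i j. i \<in> I \<Longrightarrow> j \<in> I \<Longrightarrow> i - j \<in> I" and m: "m \<in> I" "m > 0"
  obtains d where "d > 0" "\<And>i. i \<in> I \<longleftrightarrow> d dvd i"
proof -
  define D where "D = (LEAST k::nat. k > 0 \<and> int k \<in> I)"
  have ex: "nat m > 0 \<and> int (nat m) \<in> I" using m by simp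
  have D: "D > 0" "int D \<in> I"
    using LeastI[of "\<lambda>k::nat. k > 0 \<and> int k \<in> I", OF ex] by (auto simp: D_def)
  have least: "\<not> (k > 0 \<and> int k \<in> I)" if "k < D" for k
    using not_less_Least[of k "\<lambda>k::nat. k > 0 \<and> int k \<in> I"] that by (simp add: D_def)
  have zero: "0 \<in> I" using diff[OF m(1) m(1)] by simp
  have neg: "- i \<in> I" if "i \<in> I" for i using diff[OF zero that] by simp
  have add: "i + j \<in> I" if "i \<in> I" "j \<in> I" for i j using diff[OF that(1) neg[OF that(2)]] by simp
  have nmult: "int k * int D \<in> I" for k
    by (induction k) (auto simp: zero algebra_simps intro: add D)
  have mult: "k * int D \<in> I" for k
    using nmult[of "nat k"] neg[OF nmult[of "nat (- k)"]] by (cases "k \<ge> 0") auto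
  have "i \<in> I \<longleftrightarrow> int D dvd i" for i
  proof
    assume "i \<in> I"
    then have "i mod int D \<in> I"
      using diff[OF _ mult[of "i div int D"]] by (metis minus_div_mult_eq_mod)
    then have "\<not> i mod int D > 0"
      using least[of "nat (i mod int D)"] D by (auto simp: nat_less_iff)
    then show "int D dvd i"
      using D(1) pos_mod_sign[of "int D" i] by (simp add: dvd_eq_mod_eq_0 del: pos_mod_sign)
  next
    assume "int D dvd i"
    then show "i \<in> I" using mult by (metis dvdE mult.commute)
  qed
  then show thesis using that[of "int D"] D by simp
qed

lemma int_dvd_two_power:
  fixes d :: int
  assumes "d > 0" "d dvd 2 ^ k"
  obtains j where "j \<le> k" "d = 2 ^ j"
proof -
  have "nat d dvd nat (2 ^ k)" using assms by (simp add: nat_dvd_iff)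
  then have "nat d dvd 2 ^ k" by (simp add: nat_power_eq)
  then obtain j where "j \<le> k" "nat d = 2 ^ j"
    using divides_primepow_nat[of 2 "nat d" k] by auto
  then show thesis using that[of j] assms(1) by (simp add: nat_eq_iff)
qed

text \<open>Isolates what the counting needs from the presentation: \<open>x\<close> has order
  exactly \<open>2 ^ (n - 1)\<close>, \<open>y\<close> lies outside its powers, and the relations
  hold.\<close>

locale quasidihedral_group = group G for G (structure) +
  fixes n :: nat and x y
  assumes n_ge: "n \<ge> 4"
    and x_closed [simp]: "x \<in> carrier G"
    and y_closed [simp]: "y \<in> carrier G"
    and x_pow_eq_one: "x [^] (i::int) = \<one> \<longleftrightarrow> 2 ^ (n - 1) dvd i"
    and y_square: "y \<otimes> y = \<one>"
    and y_conj: "inv y \<otimes> x \<otimes> y = x [^] (2 ^ (n - 2) - 1 :: int)"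
    and y_not_x_pow: "y \<noteq> x [^] (i::int)"
    and generated: "carrier G = generate G {x, y}"
begin

text \<open>Half the order of \<open>x\<close>. Conjugation by \<open>y\<close> multiplies exponents
  by \<open>h - 1\<close>, and \<open>a h\<close> is the involution among the powers of
  \<open>x\<close>.\<close>

definition h :: int where "h = 2 ^ (n - 2)"
definition a where "a i = x [^] (i::int)"
definition b where "b i = x [^] (i::int) \<otimes> y"

section \<open>Normal forms and their multiplication rules\<close>

lemma two_power_n1: "2 ^ (n - 1) = 2 * h"
  using n_ge by (simp add: h_def flip: power_Suc)

lemma x_pow_eq_one': "x [^] (i::int) = \<one> \<longleftrightarrow> 2 * h dvd i"
  unfolding x_pow_eq_one two_power_n1 ..

lemma h_even: "even h" and h_pos: "h > 0"
  using n_ge by (auto simp: h_def)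

lemma a_closed [simp]: "a i \<in> carrier G" and b_closed [simp]: "b i \<in> carrier G"
  by (auto simp: a_def b_def)

lemma a_0: "a 0 = \<one>" by (simp add: a_def)

lemma a_a: "a i \<otimes> a j = a (i + j)"
  by (simp add: a_def int_pow_mult)

lemma a_b: "a i \<otimes> b j = b (i + j)"
  by (simp add: a_def b_def int_pow_mult m_assoc)

lemma inv_y: "inv y = y"
  using y_square by (simp add: inv_equality)

text \<open>Conjugation by \<open>y = inv y\<close> commutes with taking powers: by induction for
  natural exponents, then by inversion for negative ones. The defining relation supplies the factor
  \<open>h - 1\<close>.\<close>

lemma y_x_pow: "y \<otimes> x [^] (j::int) = x [^] ((h - 1) * j) \<otimes> y"
proof -
  have yy: "y \<otimes> (y \<otimes> z) = z" if "z \<in> carrier G" for z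
    using that y_square by (metis l_one m_assoc y_closed)
  have nat: "y \<otimes> x [^] (k::nat) \<otimes> y = (y \<otimes> x \<otimes> y) [^] k" for k
  proof (induction k)
    case (Suc k)
    have "y \<otimes> x [^] Suc k \<otimes> y = (y \<otimes> x [^] k \<otimes> y) \<otimes> (y \<otimes> x \<otimes> y)"
      by (simp add: m_assoc yy)
    then show ?case using Suc by simp
  qed (simp add: y_square)
  have eq: "y \<otimes> x [^] j \<otimes> y = (y \<otimes> x \<otimes> y) [^] j"
  proof (cases j rule: int_cases2)
    case (nonneg k)
    then show ?thesis using nat[of k] by (simp add: int_pow_int)
  next
    case (nonpos k)
    have "y \<otimes> inv (x [^] k) \<otimes> y = inv (y \<otimes> x [^] k \<otimes> y)"
      by (simp add: inv_mult_group inv_y m_assoc)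
    then show ?thesis using nonpos nat[of k] by (simp add: int_pow_neg_int)
  qed
  have "y \<otimes> x [^] j = (y \<otimes> x [^] j \<otimes> y) \<otimes> y" by (simp add: m_assoc y_square)
  also have "y \<otimes> x [^] j \<otimes> y = x [^] ((h - 1) * j)"
    using y_conj by (simp add: eq inv_y int_pow_pow h_def)
  finally show ?thesis .
qed

lemma b_a: "b i \<otimes> a j = b (i + (h - 1) * j)"
  using y_x_pow[of j] by (simp add: a_def b_def m_assoc int_pow_mult)

lemma b_b: "b i \<otimes> b j = a (i + (h - 1) * j)"
proof -
  have "b i \<otimes> b j = b i \<otimes> a j \<otimes> y" by (simp add: a_def b_def m_assoc)
  then show ?thesis by (simp add: b_a) (simp add: a_def b_def m_assoc y_square)
qed

lemma a_eq_iff: "a i = a j \<longleftrightarrow> 2 * h dvd i - j"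
proof -
  have "a i = a j \<longleftrightarrow> a i \<otimes> a (- j) = a j \<otimes> a (- j)" by (simp del: a_a)
  then show ?thesis using x_pow_eq_one'[of "i - j"] by (simp add: a_a a_0) (simp add: a_def)
qed

lemma b_eq_iff: "b i = b j \<longleftrightarrow> 2 * h dvd i - j"
  using a_eq_iff by (simp add: b_def a_def)

lemma a_neq_b: "a i \<noteq> b j"
proof
  assume "a i = b j"
  then have "a (- j) \<otimes> a i = a (- j) \<otimes> b j" by simp
  then show False using y_not_x_pow[of "i - j"] by (simp add: a_a a_b) (simp add: a_def b_def)
qed

lemma inv_a: "inv (a i) = a (- i)"
  by (rule inv_equality) (auto simp: a_a a_0)

lemma inv_b: "inv (b i) = b (- ((h - 1) * i))"
proof (rule inv_equality)
  show "b (- ((h - 1) * i)) \<otimes> b i = \<one>" by (simp add: b_b a_0)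
qed auto

lemma b_square: "b i \<otimes> b i = a (h * i)"
  by (simp add: b_b algebra_simps)

text \<open>The elements of the two shapes are closed under products and inverses and include both
  generators.\<close>

lemma carrierE:
  assumes "g \<in> carrier G"
  obtains i where "g = a i" | i where "g = b i"
proof -
  have "subgroup (range a \<union> range b) G"
    by (rule subgroupI) (auto simp: inv_a inv_b a_a a_b b_a b_b)
  moreover have "x = a 1" "y = b 0" by (simp_all add: a_def b_def)
  ultimately have "generate G {x, y} \<subseteq> range a \<union> range b"
    by (intro generate_subgroup_incl) auto
  then show thesis using assms that generated by auto
qed

section \<open>Classification of the subgroups\<close>

definition rot where "rot k = {a i | i. 2 ^ k dvd i}"
text \<open>The group \<open>rot k\<close> together with its coset through \<open>b r\<close>. It
  need not be a subgroup for every \<open>r\<close>.\<close>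

definition ref where "ref k r = rot k \<union> {b i | i. 2 ^ k dvd i - r}"

lemma power_dvd_2h: "k \<le> n - 1 \<Longrightarrow> 2 ^ k dvd 2 * h"
  by (metis two_power_n1 le_imp_power_dvd)

text \<open>Exponents matter only modulo \<open>2 * h\<close>. As \<open>2 ^ k\<close> divides
  \<open>2 * h\<close>, tests modulo \<open>2 ^ k\<close> do not depend on the chosen
  exponent.\<close>

lemma dvd_diff_cong:
  assumes "k \<le> n - 1" "2 * h dvd i - j"
  shows "2 ^ k dvd i - r \<longleftrightarrow> 2 ^ k dvd j - r"
proof -
  have "2 ^ k dvd i - j" using power_dvd_2h[OF assms(1)] assms(2) by (rule dvd_trans)
  then have "2 ^ k dvd (j - r) + (i - j) \<longleftrightarrow> 2 ^ k dvd j - r" by (rule dvd_add_left_iff)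
  then show ?thesis by simp
qed

lemma a_in_rot: "k \<le> n - 1 \<Longrightarrow> a i \<in> rot k \<longleftrightarrow> 2 ^ k dvd i"
  proof -
  assume k: "k \<le> n - 1"
  have "a i \<in> rot k \<longleftrightarrow> (\<exists>j. 2 * h dvd i - j \<and> 2 ^ k dvd j)"
    by (auto simp: rot_def a_eq_iff)
  also have "\<dots> \<longleftrightarrow> 2 ^ k dvd i"
    using dvd_diff_cong[OF k, of i _ 0] by (metis diff_0_right diff_self dvd_0_right)
  finally show ?thesis .
qed

lemma b_notin_rot: "b i \<notin> rot k"
  using a_neq_b by (auto simp: rot_def) metis

lemma a_in_ref: "k \<le> n - 1 \<Longrightarrow> a i \<in> ref k r \<longleftrightarrow> 2 ^ k dvd i"
  using a_neq_b by (auto simp: ref_def a_in_rot)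

lemma b_in_ref: "k \<le> n - 1 \<Longrightarrow> b i \<in> ref k r \<longleftrightarrow> 2 ^ k dvd i - r"
  proof -
  assume k: "k \<le> n - 1"
  have "b i \<in> ref k r \<longleftrightarrow> (\<exists>j. 2 * h dvd i - j \<and> 2 ^ k dvd j - r)"
    by (auto simp: ref_def b_notin_rot b_eq_iff)
  also have "\<dots> \<longleftrightarrow> 2 ^ k dvd i - r"
    using dvd_diff_cong[OF k] by (metis diff_self dvd_0_right)
  finally show ?thesis .
qed

lemma rot_subset: "rot k \<subseteq> carrier G" and ref_subset: "ref k r \<subseteq> carrier G"
  by (auto simp: rot_def ref_def)

lemma subset_eqI:
  assumes "H \<subseteq> carrier G" "K \<subseteq> carrier G"
    and "\<And>i. a i \<in> H \<longleftrightarrow> a i \<in> K" "\<And>i. b i \<in> H \<longleftrightarrow> b i \<in> K"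
  shows "H = K"
  using assms by (metis carrierE subsetD subsetI subset_antisym)

lemma subgroup_rot: "subgroup (rot k) G"
proof (rule subgroupI)
  show "rot k \<noteq> {}" by (auto simp: rot_def intro: exI[of _ 0])
  show "inv g \<in> rot k" if "g \<in> rot k" for g
    using that by (auto simp: rot_def inv_a)
  show "g \<otimes> g' \<in> rot k" if "g \<in> rot k" "g' \<in> rot k" for g g'
    using that by (auto simp: rot_def a_a)
qed (rule rot_subset)

text \<open>Multiplying two elements \<open>b i\<close>, \<open>b j\<close> with \<open>i\<close>
  and \<open>j\<close> congruent to \<open>r\<close> gives \<open>a\<close> of an exponent congruent
  to \<open>h * r\<close> modulo \<open>2 ^ k\<close>; the condition on \<open>r\<close> puts it
  into \<open>rot k\<close>.\<close>

lemma subgroup_ref: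
  assumes k: "k \<le> n - 1" and r: "2 ^ k dvd h * r"
  shows "subgroup (ref k r) G"
proof (rule subgroupI)
  have *: "2 ^ k dvd i + (h - 1) * j" if "2 ^ k dvd i - r" "2 ^ k dvd j - r" for i j
  proof -
    have "i + (h - 1) * j = (i - r) + (h - 1) * (j - r) + h * r" by (simp add: algebra_simps)
    then show ?thesis using that r by (metis dvd_add dvd_mult)
  qed
  show "ref k r \<subseteq> carrier G" by (rule ref_subset)
  show "ref k r \<noteq> {}" using a_in_ref[OF k, of 0] by force
  show "inv g \<in> ref k r" if "g \<in> ref k r" for g
  proof -
    have "g \<in> carrier G" using that ref_subset by blast
    then show ?thesis
    proof (cases rule: carrierE)
      case (2 i)
      then have i: "2 ^ k dvd i - r" using that by (simp add: b_in_ref[OF k])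
      \<comment> \<open>The exponent of the inverse is split so that the second term is the exponent
        of \<open>b i\<close> squared, already known to be divisible.\<close>
      have "- ((h - 1) * i) - r = (i - r) - (i + (h - 1) * i)" by simp
      then have "2 ^ k dvd - ((h - 1) * i) - r" using i *[OF i i] by (metis dvd_diff)
      then show ?thesis by (simp add: 2 inv_b b_in_ref[OF k])
    qed (use that in \<open>simp add: inv_a a_in_ref[OF k]\<close>)
  qed
  show "g \<otimes> g' \<in> ref k r" if "g \<in> ref k r" "g' \<in> ref k r" for g g'
  proof -
    have "g \<in> carrier G" "g' \<in> carrier G" using that ref_subset by blast+
    then show ?thesis
    proof (elim carrierE)
      fix i j assume [simp]: "g = a i" "g' = b j"
      have "2 ^ k dvd i" "2 ^ k dvd j - r" using that by (simp_all add: a_in_ref[OF k] b_in_ref[OF k])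
      then have "2 ^ k dvd i + (j - r)" by (rule dvd_add)
      then show ?thesis by (simp add: a_b b_in_ref[OF k] algebra_simps)
    next
      fix i j assume [simp]: "g = b i" "g' = a j"
      have "2 ^ k dvd j" "2 ^ k dvd i - r" using that by (simp_all add: a_in_ref[OF k] b_in_ref[OF k])
      then have "2 ^ k dvd (i - r) + (h - 1) * j" by (intro dvd_add dvd_mult)
      then show ?thesis by (simp add: b_a b_in_ref[OF k] algebra_simps)
    qed (use that * in \<open>auto simp: a_a b_b a_in_ref[OF k] b_in_ref[OF k]\<close>)
  qed
qed

lemma subgroup_cases:
  assumes H: "subgroup H G"
  obtains k where "k \<le> n - 1" "H = rot k"
  | k r where "k \<le> n - 1" "0 \<le> r" "r < 2 ^ k" "2 ^ k dvd h * r" "H = ref k r"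
proof -
  interpret H: subgroup H G by (rule H)
  have a_diff: "a (i - j) \<in> H" if "a i \<in> H" "a j \<in> H" for i j
    using H.m_closed[OF that(1) H.m_inv_closed[OF that(2)]] by (simp add: inv_a a_a)
  \<comment> \<open>This is the identity. It gives a positive exponent in \<open>H\<close>, and
    later forces \<open>d\<close> to divide \<open>2 ^ (n - 1)\<close>.\<close>
  have "a (2 * h) \<in> H" using H.one_closed x_pow_eq_one'[of "2 * h"] by (simp add: a_def)
  moreover have "2 * h > 0" using h_pos by simp
  ultimately obtain d where d: "d > 0" "\<And>i. a i \<in> H \<longleftrightarrow> d dvd i"
    using int_subgroup_eq_multiples[of "{i. a i \<in> H}" "2 * h"] a_diff by auto
  then have "d dvd 2 ^ (n - 1)" using \<open>a (2 * h) \<in> H\<close> unfolding two_power_n1 by simp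
  then obtain k where k: "k \<le> n - 1" "d = 2 ^ k" using int_dvd_two_power d(1) by blast
  have a_iff: "a i \<in> H \<longleftrightarrow> 2 ^ k dvd i" for i using d(2) k(2) by simp
  show thesis
  proof (cases "\<exists>j. b j \<in> H")
    case False
    then have "H = rot k"
      by (intro subset_eqI) (auto simp: H.subset rot_subset a_in_rot[OF k(1)] a_iff b_notin_rot)
    then show thesis using that(1) k by blast
  next
    case True
    then obtain j where j: "b j \<in> H" by blast
    \<comment> \<open>The reduced residue, so that each subgroup receives only one index.\<close>
    define r where "r = j mod 2 ^ k"
    have b_iff: "b i \<in> H \<longleftrightarrow> 2 ^ k dvd i - j" for i
    proof
      assume "b i \<in> H"
      then have "b i \<otimes> inv (b j) \<in> H" using j by (intro H.m_closed H.m_inv_closed)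
      moreover have "b i \<otimes> inv (b j) = a (i - j)"
      proof -
        have "a (i - j) \<otimes> b j = b i" by (simp add: a_b)
        then show ?thesis by (metis a_closed b_closed inv_solve_right)
      qed
      ultimately show "2 ^ k dvd i - j" using d k by simp
    next
      assume "2 ^ k dvd i - j"
      then have "a (i - j) \<otimes> b j \<in> H" using d k j by (intro H.m_closed) simp_all
      then show "b i \<in> H" by (simp add: a_b)
    qed
    have cong: "2 ^ k dvd i - j \<longleftrightarrow> 2 ^ k dvd i - r" for i
      by (simp add: r_def mod_eq_dvd_iff[symmetric])
    have r: "b r \<in> H" using cong[of r] by (simp add: b_iff)
    \<comment> \<open>Squaring \<open>b r\<close> lands among the powers of \<open>x\<close>, which
      yields the condition on \<open>r\<close>.\<close>
    have "a (h * r) \<in> H" using H.m_closed[OF r r] by (simp add: b_square)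
    then have "2 ^ k dvd h * r" using d k by simp
    moreover have "H = ref k r"
      by (intro subset_eqI)
        (auto simp: H.subset ref_subset a_in_ref[OF k(1)] b_in_ref[OF k(1)] b_iff cong a_iff)
    moreover have "0 \<le> r" "r < 2 ^ k" by (simp_all add: r_def)
    ultimately show thesis using that(2) k by blast
  qed
qed

section \<open>Indexing and counting of the subgroups\<close>

definition ref_index :: "(nat \<times> int) set" where
  "ref_index = {(k, r). k \<le> n - 1 \<and> 0 \<le> r \<and> r < 2 ^ k \<and> 2 ^ k dvd h * r}"

text \<open>The first block indexes the subgroups of order 2, by even residues modulo
  \<open>2 * h\<close>; the second those of order 4, by odd residues modulo \<open>h\<close>.
  Injective images make both blocks easy to count.\<close>

definition cyclic_ref_index :: "(nat \<times> int) set" where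
  "cyclic_ref_index = {n - 1} \<times> ((\<lambda>i. 2 * i) ` {0..<h}) \<union> {n - 2} \<times> ((\<lambda>i. 2 * i + 1) ` {0..<2 ^ (n - 3)})"

lemma subgroups_of_eq: "subgroups_of G = rot ` {..n - 1} \<union> case_prod ref ` ref_index"
proof
  show "subgroups_of G \<subseteq> rot ` {..n - 1} \<union> case_prod ref ` ref_index"
    by (auto simp: subgroups_of_def ref_index_def elim!: subgroup_cases)
qed (auto simp: subgroups_of_def ref_index_def subgroup_rot subgroup_ref)

lemma inj_on_rot: "inj_on rot {..n - 1}"
proof (rule inj_onI)
  fix k l assume *: "k \<in> {..n - 1}" "l \<in> {..n - 1}" "rot k = rot l"
  have eq: "(2::int) ^ k dvd i \<longleftrightarrow> 2 ^ l dvd i" for i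
    using * a_in_rot by (metis atMost_iff)
  have "(2::int) ^ k dvd 2 ^ l" "(2::int) ^ l dvd 2 ^ k"
    by (simp only: eq dvd_refl, simp only: eq[symmetric] dvd_refl)
  then show "k = l" by (simp add: dvd_power_iff)
qed

text \<open>The powers of \<open>x\<close> in the subgroup determine \<open>k\<close>; the remaining
  elements determine \<open>r\<close> modulo \<open>2 ^ k\<close>, and \<open>r\<close> is
  reduced.\<close>

lemma inj_on_ref: "inj_on (case_prod ref) ref_index"
proof (rule inj_onI, clarify)
  fix k l r s assume *: "(k, r) \<in> ref_index" "(l, s) \<in> ref_index" "ref k r = ref l s"
  then have kl: "k \<le> n - 1" "l \<le> n - 1" by (auto simp: ref_index_def)
  have eq: "(2::int) ^ k dvd i \<longleftrightarrow> 2 ^ l dvd i" for i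
    using * kl a_in_ref by metis
  have "(2::int) ^ k dvd 2 ^ l" "(2::int) ^ l dvd 2 ^ k"
    by (simp only: eq dvd_refl, simp only: eq[symmetric] dvd_refl)
  then have "k = l" by (simp add: dvd_power_iff)
  moreover have "2 ^ k dvd r - s"
    using * kl b_in_ref \<open>k = l\<close> by (metis diff_self dvd_0_right)
  then have "r mod 2 ^ k = s mod 2 ^ k" by (simp add: mod_eq_dvd_iff)
  then have "r = s" using * \<open>k = l\<close> by (auto simp: ref_index_def)
  ultimately show "k = l \<and> r = s" by simp
qed

lemma rot_ref_disjoint:
  assumes "Q \<subseteq> ref_index"
  shows "rot ` {..n - 1} \<inter> case_prod ref ` Q = {}"
proof -
  have "rot k \<noteq> ref l r" if "(l, r) \<in> ref_index" for k l r
    using that b_notin_rot[of r k] b_in_ref[of l r r] by (auto simp: ref_index_def)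
  then show ?thesis using assms by fastforce
qed

lemma h_half: "h = 2 * 2 ^ (n - 3)"
proof -
  have "n - 2 = Suc (n - 3)" using n_ge by simp
  then show ?thesis by (simp add: h_def)
qed

lemma ref_index_eq:
  "ref_index = (SIGMA k:{..<n - 1}. {0..<2 ^ k}) \<union> {n - 1} \<times> ((\<lambda>i. 2 * i) ` {0..<h})"
proof -
  have "2 ^ k dvd h * r" if "k < n - 1" for k r
    using that unfolding h_def by (intro dvd_mult2 le_imp_power_dvd) simp
  moreover have "2 * h dvd h * r \<longleftrightarrow> even r" for r
    using h_pos by (simp add: mult.commute[of 2])
  moreover have "r \<in> (\<lambda>i. 2 * i) ` {0..<h} \<longleftrightarrow> 0 \<le> r \<and> r < 2 * h \<and> even r" for r
    by (auto elim!: evenE)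
  ultimately show ?thesis
    by (auto simp: ref_index_def two_power_n1[unfolded One_nat_def] le_less)
qed

lemma cyclic_ref_index_iff:
  "(k, r) \<in> cyclic_ref_index \<longleftrightarrow>
    (k, r) \<in> ref_index \<and> (k = n - 1 \<or> k = n - 2 \<and> odd r)"
proof -
  have "r \<in> (\<lambda>i. 2 * i + 1) ` {0..<2 ^ (n - 3)} \<longleftrightarrow> 0 \<le> r \<and> r < h \<and> odd r"
    by (auto simp: h_half elim!: oddE)
  moreover have "n - 2 < n - 1" "n - 1 \<noteq> n - 2" using n_ge by auto
  ultimately show ?thesis
    unfolding cyclic_ref_index_def ref_index_eq by (auto simp flip: h_def)
qed

lemma card_ref_index: "card ref_index = 3 * 2 ^ (n - 2) - 1"
proof -
  have "card (SIGMA k:{..<n - 1}. {0..<2 ^ k :: int}) = (\<Sum>k<n - 1. 2 ^ k)"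
    by (simp add: nat_power_eq)
  \<comment> \<open>Geometric sum: level \<open>k\<close> contributes all \<open>2 ^ k\<close>
    residues.\<close>
  also have "\<dots> = 2 ^ (n - 1) - 1" using mask_eq_sum_exp_nat[of "n - 1"] by (simp add: lessThan_def)
  finally have 1: "card (SIGMA k:{..<n - 1}. {0..<2 ^ k :: int}) = 2 ^ (n - 1) - 1" .
  have 2: "card ({n - 1} \<times> ((\<lambda>i. 2 * i) ` {0..<h})) = 2 ^ (n - 2)"
    by (simp add: card_cartesian_product card_image inj_on_def h_def nat_power_eq)
  have "card ref_index = 2 ^ (n - 1) - 1 + 2 ^ (n - 2)"
    unfolding ref_index_eq 1[symmetric] 2[symmetric] by (rule card_Un_disjoint) auto
  moreover have "(2::nat) ^ (n - 1) = 2 * 2 ^ (n - 2)"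
  proof -
    have "n - 1 = Suc (n - 2)" using n_ge by simp
    then show ?thesis by simp
  qed
  ultimately show ?thesis by simp
qed

lemma card_cyclic_ref_index: "card cyclic_ref_index = 3 * 2 ^ (n - 3)"
proof -
  have "card ({n - 1} \<times> ((\<lambda>i. 2 * i) ` {0..<h})) = 2 * 2 ^ (n - 3)"
    by (simp add: card_cartesian_product card_image inj_on_def h_half nat_mult_distrib nat_power_eq)
  moreover have "card ({n - 2} \<times> ((\<lambda>i. 2 * i + 1) ` {0..<2 ^ (n - 3) :: int})) = 2 ^ (n - 3)"
    by (simp add: card_cartesian_product card_image inj_on_def nat_power_eq)
  moreover have "n - 1 \<noteq> n - 2" using n_ge by simp
  ultimately show ?thesis
    unfolding cyclic_ref_index_def by (subst card_Un_disjoint) auto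
qed

section \<open>Determination of the cyclic subgroups\<close>

lemma rot_cyclic: "rot k = range (\<lambda>j::int. a (2 ^ k) [^] j)"
  by (auto simp: rot_def a_def int_pow_pow elim!: dvdE)

lemma b_even_pow: "b i [^] (2 * j :: int) = a (h * i * j)"
proof -
  have "b i [^] (2::int) = b i \<otimes> b i" using int_pow_mult[of "b i" 1 1] by simp
  then have "b i [^] (2 * j) = a (h * i) [^] j" by (simp add: b_square flip: int_pow_pow)
  then show ?thesis by (simp add: a_def int_pow_pow)
qed

lemma b_odd_pow: "b i [^] (2 * j + 1 :: int) = b (h * i * j + i)"
  by (simp add: int_pow_mult b_even_pow a_b)

text \<open>A generator must be some \<open>b i\<close>, and only its even powers are powers of
  \<open>x\<close>; these have exponents divisible by \<open>h\<close>. Reaching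
  \<open>a (2 ^ k)\<close> thus needs \<open>k \<ge> n - 2\<close>.\<close>

lemma ref_cyclicD:
  assumes k: "k \<le> n - 1" and g: "g \<in> ref k r" and eq: "ref k r = range (\<lambda>j::int. g [^] j)"
  shows "k = n - 1 \<or> k = n - 2 \<and> odd r"
proof -
  obtain i where i: "g = b i"
  proof -
    have "g \<in> carrier G" using g ref_subset by blast
    then consider i where "g = a i" | i where "g = b i" by (rule carrierE)
    then show thesis
    proof cases
      case (1 i)
      \<comment> \<open>Powers of \<open>a i\<close> never leave the powers of \<open>x\<close>, so
        they miss \<open>b r\<close>.\<close>
      obtain j :: int where "b r = g [^] j" using b_in_ref[OF k, of r r] eq by auto
      then show thesis using 1 a_neq_b[of "i * j" r] by (simp add: a_def int_pow_pow)
    qed (rule that)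
  qed
  obtain j :: int where j: "a (2 ^ k) = g [^] j" using a_in_ref[OF k, of "2 ^ k" r] eq by auto
  have "even j"
  proof (rule ccontr)
    assume "odd j"
    then show False using j a_neq_b by (auto simp: i b_odd_pow elim!: oddE)
  qed
  then obtain l where "j = 2 * l" by (rule evenE)
  then have l: "2 * h dvd 2 ^ k - h * i * l" using j by (simp add: i b_even_pow a_eq_iff)
  then have "h dvd (2 ^ k - h * i * l) + h * (i * l)" by (intro dvd_add) (auto intro: dvd_mult_right)
  then have "(2::int) ^ (n - 2) dvd 2 ^ k" by (simp add: h_def mult.assoc)
  then have "n - 2 \<le> k" by (simp add: dvd_power_iff)
  then consider "k = n - 1" | "k = n - 2" using k by linarith
  then show ?thesis
  proof cases
    case 2
    \<comment> \<open>Here \<open>2 ^ k = h\<close>. Cancelling \<open>h\<close> makes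
      \<open>i * l\<close> odd, and \<open>i\<close> has the parity of \<open>r\<close> because
      \<open>h\<close> is even.\<close>
    have "h * 2 dvd h * (1 - i * l)" using l 2 by (simp add: h_def algebra_simps)
    then have "odd i" using h_pos by auto
    moreover have "even (i - r)"
      using g h_even unfolding i b_in_ref[OF k] by (metis 2 dvd_trans h_def)
    ultimately show ?thesis using 2 by simp
  qed simp
qed

lemma ref_cyclicI:
  assumes "(k, r) \<in> ref_index" "k = n - 1 \<or> k = n - 2 \<and> odd r"
  shows "ref k r = range (\<lambda>j::int. b r [^] j)"
proof -
  have k: "k \<le> n - 1" and hr: "2 ^ k dvd h * r" using assms by (auto simp: ref_index_def)
  have sub: "subgroup (ref k r) G" by (rule subgroup_ref[OF k hr])
  have "b r \<in> ref k r" by (simp add: b_in_ref[OF k])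
  then have le: "range (\<lambda>j::int. b r [^] j) \<subseteq> ref k r"
    using subgroup_int_pow_closed[OF sub] by blast
  \<comment> \<open>In other words, \<open>a i\<close> is the power of \<open>b r\<close> with
    exponent \<open>2 * l\<close>. One further factor \<open>b r\<close> handles the elements
    outside the powers of \<open>x\<close>.\<close>
  have ex: "\<exists>l. 2 * h dvd i - h * r * l" if i: "2 ^ k dvd i" for i
    using assms(2)
  proof
    assume "k = n - 1"
    then show ?thesis using i by (intro exI[of _ 0]) (simp flip: two_power_n1)
  next
    assume kr: "k = n - 2 \<and> odd r"
    then obtain q where q: "i = h * q" using i by (auto simp: h_def elim: dvdE)
    \<comment> \<open>The witness is \<open>l = q\<close>: since \<open>r\<close> is odd,
      \<open>1 - r\<close> supplies the missing factor 2.\<close>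
    have "i - h * r * q = h * (q * (1 - r))" by (simp add: q algebra_simps)
    moreover have "h * 2 dvd h * (q * (1 - r))" using kr by (intro mult_dvd_mono) auto
    ultimately show ?thesis by (metis mult.commute)
  qed
  have "ref k r \<subseteq> range (\<lambda>j::int. b r [^] j)"
  proof
    fix g assume g: "g \<in> ref k r"
    then have "g \<in> carrier G" using ref_subset by blast
    then show "g \<in> range (\<lambda>j::int. b r [^] j)"
    proof (cases rule: carrierE)
      case (1 i)
      then obtain l where "2 * h dvd i - h * r * l" using g ex by (auto simp: a_in_ref[OF k])
      then have "g = b r [^] (2 * l)" by (simp add: 1 b_even_pow a_eq_iff)
      then show ?thesis by blast
    next
      case (2 i)
      then obtain l where "2 * h dvd i - r - h * r * l" using g ex by (auto simp: b_in_ref[OF k])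
      then have "2 * h dvd i - (h * r * l + r)" by (simp add: algebra_simps)
      then have "g = b r [^] (2 * l + 1)" by (simp only: 2 b_odd_pow b_eq_iff)
      then show ?thesis by blast
    qed
  qed
  with le show ?thesis by blast
qed

lemma cyclic_subgroups_of_eq:
  "cyclic_subgroups_of G = rot ` {..n - 1} \<union> case_prod ref ` cyclic_ref_index"
proof
  show "cyclic_subgroups_of G \<subseteq> rot ` {..n - 1} \<union> case_prod ref ` cyclic_ref_index"
  proof
    fix H assume "H \<in> cyclic_subgroups_of G"
    then obtain g where H: "subgroup H G" and g: "g \<in> H" "H = range (\<lambda>k::int. g [^] k)"
      unfolding cyclic_subgroups_of_iff by blast
    from H show "H \<in> rot ` {..n - 1} \<union> case_prod ref ` cyclic_ref_index"
    proof (cases rule: subgroup_cases)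
      case (2 k r)
      have "k = n - 1 \<or> k = n - 2 \<and> odd r"
        by (rule ref_cyclicD[OF 2(1) g[unfolded 2(5)]])
      moreover have "(k, r) \<in> ref_index" using 2 by (simp add: ref_index_def)
      ultimately have "(k, r) \<in> cyclic_ref_index" by (simp only: cyclic_ref_index_iff)
      then have "case_prod ref (k, r) \<in> case_prod ref ` cyclic_ref_index" by (rule imageI)
      then show ?thesis using 2(5) by simp
    next
      case (1 k)
      then show ?thesis by blast
    qed
  qed
  have "rot k \<in> cyclic_subgroups_of G" for k
  proof -
    have "a (2 ^ k) \<in> rot k" by (auto simp: rot_def)
    then show ?thesis unfolding cyclic_subgroups_of_iff using subgroup_rot rot_cyclic by blast
  qed
  moreover have "ref k r \<in> cyclic_subgroups_of G" if kr: "(k, r) \<in> cyclic_ref_index" for k r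
  proof -
    have *: "(k, r) \<in> ref_index" "k = n - 1 \<or> k = n - 2 \<and> odd r"
      using kr by (auto simp: cyclic_ref_index_iff)
    then have k: "k \<le> n - 1" "2 ^ k dvd h * r" by (auto simp: ref_index_def)
    have "b r \<in> ref k r" by (simp add: b_in_ref[OF k(1)])
    then show ?thesis
      unfolding cyclic_subgroups_of_iff
      using subgroup_ref[OF k] ref_cyclicI[OF *] by blast
  qed
  ultimately show "rot ` {..n - 1} \<union> case_prod ref ` cyclic_ref_index \<subseteq> cyclic_subgroups_of G"
    by auto
qed

section \<open>The two cardinalities and their quotient\<close>

lemma finite_ref_index: "finite ref_index"
  by (simp add: ref_index_eq)

lemma cyclic_ref_index_subset: "cyclic_ref_index \<subseteq> ref_index"
  using cyclic_ref_index_iff by auto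

text \<open>Serves both counts. The summand \<open>n\<close> comes from the levels \<open>0\<close>
  to \<open>n - 1\<close> of \<open>rot\<close>.\<close>

lemma card_rot_ref:
  assumes "Q \<subseteq> ref_index"
  shows "card (rot ` {..n - 1} \<union> case_prod ref ` Q) = n + card Q"
proof -
  have "card (rot ` {..n - 1}) = n" using n_ge by (subst card_image[OF inj_on_rot]) simp
  moreover have "card (case_prod ref ` Q) = card Q"
    by (rule card_image[OF inj_on_subset[OF inj_on_ref assms]])
  moreover have "finite Q" using assms finite_ref_index by (rule finite_subset)
  ultimately show ?thesis using rot_ref_disjoint[OF assms] by (simp add: card_Un_disjoint)
qed

lemma card_subgroups: "card (subgroups_of G) = 3 * 2 ^ (n - 2) + n - 1"
proof -
  have "3 * 2 ^ (n - 2) \<ge> (1::nat)" by simp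
  then show ?thesis
    using card_rot_ref[of ref_index] by (simp add: subgroups_of_eq card_ref_index)
qed

lemma card_cyclic_subgroups: "card (cyclic_subgroups_of G) = 3 * 2 ^ (n - 3) + n"
  using card_rot_ref[OF cyclic_ref_index_subset]
  by (simp add: cyclic_subgroups_of_eq card_cyclic_ref_index)

lemma cdeg_eq: "cdeg G = (3 * 2 ^ (n - 3) + real n) / (3 * 2 ^ (n - 2) + real n - 1)"
proof -
  \<comment> \<open>Lets the truncated subtraction of naturals become subtraction of reals.\<close>
  have "1 \<le> 3 * 2 ^ (n - 2) + n" using n_ge by simp
  then show ?thesis
    by (simp add: cdeg_def card_subgroups card_cyclic_subgroups of_nat_diff)
qed

end

section \<open>The presented group\<close>

definition qd_rel :: "nat \<Rightarrow> (xy word \<times> xy word) set" where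
  "qd_rel n =
     {(replicate (2 ^ (n - 1)) (Gen X), []),
      (replicate 2 (Gen Y), []),
      ([Inv Y, Gen X, Gen Y], replicate (2 ^ (n - 2) - 1) (Gen X))}"

text \<open>
  Left multiplication by a letter, where \<open>(i, False)\<close> stands for \<open>x ^ i\<close> and \<open>(i, True)\<close>
  for \<open>x ^ i * y\<close>. Keeping \<open>i\<close> an unreduced integer makes the relations hold only up to \<open>qd_sim\<close>.
\<close>

fun qd_act :: "nat \<Rightarrow> xy letter \<Rightarrow> int \<times> bool \<Rightarrow> int \<times> bool" where
  "qd_act n (Gen X) (i, s) = (i + 1, s)"
| "qd_act n (Inv X) (i, s) = (i - 1, s)"
| "qd_act n (Gen Y) (i, s) = ((2 ^ (n - 2) - 1) * i, \<not> s)"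
| "qd_act n (Inv Y) (i, s) = ((2 ^ (n - 2) - 1) * i, \<not> s)"

definition qd_sim :: "nat \<Rightarrow> int \<times> bool \<Rightarrow> int \<times> bool \<Rightarrow> bool" where
  "qd_sim n p q \<longleftrightarrow> 2 ^ (n - 1) dvd fst p - fst q \<and> snd p = snd q"

lemma qd_sim_Pair: "qd_sim n (i, s) (j, t) \<longleftrightarrow> 2 ^ (n - 1) dvd i - j \<and> s = t"
  by (simp add: qd_sim_def)

lemma qd_sim_refl: "qd_sim n p p"
  by (simp add: qd_sim_def)

lemma qd_sim_sym: "qd_sim n p q \<Longrightarrow> qd_sim n q p"
  by (simp add: qd_sim_def dvd_diff_commute)

lemma qd_sim_trans: "qd_sim n p q \<Longrightarrow> qd_sim n q r \<Longrightarrow> qd_sim n p r"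
  using dvd_add[of "2 ^ (n - 1)" "fst p - fst q" "fst q - fst r"] by (simp add: qd_sim_def)

text \<open>Each letter acts on the exponent by an affine map with integer coefficients.\<close>

lemma qd_act_sim: "qd_sim n p q \<Longrightarrow> qd_sim n (qd_act n l p) (qd_act n l q)"
proof -
  assume "qd_sim n p q"
  moreover have "(2 ^ (n - 2) - 1) * i - (2 ^ (n - 2) - 1) * j = (2 ^ (n - 2) - 1) * (i - j :: int)" for i j
    by (simp add: algebra_simps)
  ultimately show ?thesis
    by (cases "(n, l, p)" rule: qd_act.cases; cases q) (auto simp: qd_sim_def)
qed

lemma foldr_qd_act_sim: "qd_sim n p q \<Longrightarrow> qd_sim n (foldr (qd_act n) w p) (foldr (qd_act n) w q)"
  by (induction w) (auto intro: qd_act_sim)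

lemma qd_act_X_pow: "(qd_act n (Gen X) ^^ k) (i, s) = (i + int k, s)"
  by (induction k) auto

lemma qd_act_inv_X_pow: "(qd_act n (Inv X) ^^ k) (i, s) = (i - int k, s)"
  by (induction k) auto

text \<open>The square of \<open>2 ^ (n - 2) - 1\<close> is 1 modulo \<open>2 ^ (n - 1)\<close>, so
  \<open>Y\<close> acts as an involution up to \<open>qd_sim\<close>.\<close>

lemma qd_square_dvd:
  assumes "n \<ge> 4"
  shows "(2::int) ^ (n - 1) dvd (2 ^ (n - 2) - 1) * ((2 ^ (n - 2) - 1) * i) - i"
proof -
  have "(2 ^ (n - 2) - 1) * ((2 ^ (n - 2) - 1) * i) - i = 2 * 2 ^ (n - 2) * ((2 ^ (n - 3) - 1) * i)"
  proof -
    have "n - 2 = Suc (n - 3)" using assms by simp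
    then show ?thesis by (simp add: algebra_simps)
  qed
  moreover have "(2::int) ^ (n - 1) = 2 * 2 ^ (n - 2)" using assms by (simp flip: power_Suc)
  ultimately show ?thesis by simp
qed

text \<open>The suffix \<open>v\<close> only moves the starting point and the prefix
  \<open>u\<close> preserves \<open>qd_sim\<close>, so it suffices to compare the two sides of each
  elementary relation.\<close>

lemma word_eq_sim:
  assumes "word_eq (qd_rel n) u v" and n: "n \<ge> 4"
  shows "qd_sim n (foldr (qd_act n) u p) (foldr (qd_act n) v p)"
  using assms(1)
proof (induction arbitrary: p rule: word_eq.induct)
  case (Gen_Inv u g v)
  obtain i s where v: "foldr (qd_act n) v p = (i, s)" by fastforce
  show ?case
    using qd_square_dvd[OF n, of i]
    by (cases g) (auto simp: v qd_sim_Pair intro!: foldr_qd_act_sim)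
next
  case (Inv_Gen u g v)
  obtain i s where v: "foldr (qd_act n) v p = (i, s)" by fastforce
  show ?case
    using qd_square_dvd[OF n, of i]
    by (cases g) (auto simp: v qd_sim_Pair intro!: foldr_qd_act_sim)
next
  case (rel l r u v)
  obtain i s where v: "foldr (qd_act n) v p = (i, s)" by fastforce
  have "qd_sim n (foldr (qd_act n) l (i, s)) (foldr (qd_act n) r (i, s))"
  proof -
    have "(f ^^ 2) p = f (f p)" for f :: "int \<times> bool \<Rightarrow> int \<times> bool" and p
      by (simp add: numeral_2_eq_2)
    \<comment> \<open>The conjugation relation: the exponents produced from \<open>i\<close> by its
      left and right sides.\<close>
    moreover have "2 ^ (n - 1) dvd (2 ^ (n - 2) - 1) * ((2 ^ (n - 2) - 1) * i + 1) - (i + (2 ^ (n - 2) - 1))"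
      using qd_square_dvd[OF n, of i] by (simp add: algebra_simps)
    ultimately show ?thesis
      using rel qd_square_dvd[OF n, of i]
      by (auto simp: qd_rel_def qd_act_X_pow qd_sim_Pair of_nat_diff)
  qed
  then show ?case by (auto simp: v intro!: foldr_qd_act_sim)
qed (blast intro: qd_sim_refl qd_sim_sym qd_sim_trans)+

section \<open>The presented group as an instance of the locale\<close>

lemma presented_group_pow:
  "(word_rel R `` {u}) [^]\<^bsub>presented_group R\<^esub> (k::nat) = word_rel R `` {concat (replicate k u)}"
proof (induction k)
  case (Suc k)
  \<comment> \<open>Powers grow on the right, \<open>replicate\<close> on the left.\<close>
  have "concat (replicate k u) @ u = u @ concat (replicate k u)" by (induction k) auto
  then show ?case using Suc by (simp add: presented_group_mult_class)
qed (simp add: one_presented_group)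

lemma concat_replicate_singleton: "concat (replicate k [l]) = replicate k l"
  by (induction k) auto

lemma presented_group_inv_Gen:
  "inv\<^bsub>presented_group R\<^esub> (word_rel R `` {[Gen g]}) = word_rel R `` {[Inv g]}"
proof -
  interpret group "presented_group R" by (rule group_presented_group)
  have "word_rel R `` {[Inv g]} \<otimes>\<^bsub>presented_group R\<^esub> word_rel R `` {[Gen g]} = \<one>\<^bsub>presented_group R\<^esub>"
    using word_eq.Inv_Gen[of R "[]" g "[]"]
    by (simp add: presented_group_mult_class one_presented_group word_rel_eq_iff)
  then show ?thesis by (intro inv_equality) (auto simp: carrier_presented_group)
qed

lemma carrier_presented_group_subset:
  assumes "subgroup H (presented_group R)" and gen: "\<And>g. word_rel R `` {[Gen g]} \<in> H"
  shows "carrier (presented_group R) \<subseteq> H"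
proof -
  interpret H: subgroup H "presented_group R" by fact
  have letter: "word_rel R `` {[l]} \<in> H" for l
    using gen H.m_inv_closed[OF gen] by (cases l) (auto simp: presented_group_inv_Gen)
  have "word_rel R `` {w} \<in> H" for w
  proof (induction w)
    case Nil
    show ?case using H.one_closed by (simp add: one_presented_group)
  next
    case (Cons l w)
    then show ?case
      using H.m_closed[OF letter[of l] Cons] by (simp add: presented_group_mult_class)
  qed
  then show ?thesis by (auto simp: carrier_presented_group)
qed

text \<open>The equations come from the relations; the exact order of \<open>x\<close> and the
  position of \<open>y\<close> come from acting on \<open>(0, False)\<close>.\<close>

lemma quasidihedral_group_presented:
  assumes n: "n \<ge> 4"
  shows "quasidihedral_group (quasidihedral n) n
    (word_rel (qd_rel n) `` {[Gen X]}) (word_rel (qd_rel n) `` {[Gen Y]})"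
proof -
  let ?R = "qd_rel n"
  let ?x = "word_rel ?R `` {[Gen X]}" and ?y = "word_rel ?R `` {[Gen Y]}"
  interpret group "presented_group ?R" by (rule group_presented_group)
  have closed: "word_rel ?R `` {w} \<in> carrier (presented_group ?R)" for w
    by (auto simp: carrier_presented_group)
  \<comment> \<open>A representing word whose action on \<open>(0, False)\<close> reads off the
    exponent \<open>i\<close>.\<close>
  have pow_word: "\<exists>w. ?x [^]\<^bsub>presented_group ?R\<^esub> i = word_rel ?R `` {w}
      \<and> foldr (qd_act n) w (0, False) = (i, False)" for i :: int
  proof (cases i rule: int_cases2)
    case (nonneg k)
    then show ?thesis
      by (intro exI[of _ "replicate k (Gen X)"])
        (simp add: int_pow_int presented_group_pow concat_replicate_singleton qd_act_X_pow)
  next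
    case (nonpos k)
    have "?x [^]\<^bsub>presented_group ?R\<^esub> i = word_rel ?R `` {replicate k (Inv X)}"
      unfolding nonpos int_pow_neg_int[OF closed] nat_pow_inv[OF closed, symmetric]
      by (simp only: presented_group_inv_Gen presented_group_pow concat_replicate_singleton)
    then show ?thesis
      by (intro exI[of _ "replicate k (Inv X)"]) (simp add: nonpos qd_act_inv_X_pow)
  qed
  have rel: "word_rel ?R `` {l} = word_rel ?R `` {r}" if "(l, r) \<in> ?R" for l r
    using word_eq.rel[OF that, of "[]" "[]"] by (simp add: word_rel_eq_iff)
  have rel_x: "word_rel ?R `` {replicate (2 ^ (n - 1)) (Gen X)} = word_rel ?R `` {[]}"
    and rel_y: "word_rel ?R `` {[Gen Y, Gen Y]} = word_rel ?R `` {[]}"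
    and rel_conj: "word_rel ?R `` {[Inv Y, Gen X, Gen Y]} = word_rel ?R `` {replicate (2 ^ (n - 2) - 1) (Gen X)}"
    by (rule rel; simp add: qd_rel_def numeral_2_eq_2)+
  have "?x [^]\<^bsub>presented_group ?R\<^esub> (2 ^ (n - 1) :: nat) = \<one>\<^bsub>presented_group ?R\<^esub>"
    by (simp only: presented_group_pow concat_replicate_singleton one_presented_group rel_x)
  then have x_order: "?x [^]\<^bsub>presented_group ?R\<^esub> (2 ^ (n - 1) :: int) = \<one>\<^bsub>presented_group ?R\<^esub>"
    by (metis int_pow_int of_nat_numeral of_nat_power)
  have "quasidihedral_group (presented_group ?R) n ?x ?y"
  proof unfold_locales
    show "?x [^]\<^bsub>presented_group ?R\<^esub> i = \<one>\<^bsub>presented_group ?R\<^esub> \<longleftrightarrow> 2 ^ (n - 1) dvd i" for i :: int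
    proof
      assume *: "?x [^]\<^bsub>presented_group ?R\<^esub> i = \<one>\<^bsub>presented_group ?R\<^esub>"
      obtain w where w: "?x [^]\<^bsub>presented_group ?R\<^esub> i = word_rel ?R `` {w}"
        "foldr (qd_act n) w (0, False) = (i, False)" using pow_word by blast
      then have "word_eq ?R w []" using * by (simp only: w(1) one_presented_group word_rel_eq_iff)
      from word_eq_sim[OF this n, of "(0, False)"] show "2 ^ (n - 1) dvd i"
        by (simp add: w qd_sim_def)
    next
      assume "2 ^ (n - 1) dvd i"
      then obtain j where "i = 2 ^ (n - 1) * j" by blast
      then show "?x [^]\<^bsub>presented_group ?R\<^esub> i = \<one>\<^bsub>presented_group ?R\<^esub>"
        using x_order by (simp add: closed flip: int_pow_pow)
    qed
    show "?y \<noteq> ?x [^]\<^bsub>presented_group ?R\<^esub> i" for i :: int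
    proof
      assume *: "?y = ?x [^]\<^bsub>presented_group ?R\<^esub> i"
      obtain w where w: "?x [^]\<^bsub>presented_group ?R\<^esub> i = word_rel ?R `` {w}"
        "foldr (qd_act n) w (0, False) = (i, False)" using pow_word by blast
      then have "word_eq ?R [Gen Y] w" using * by (simp only: w(1) word_rel_eq_iff)
      \<comment> \<open>The letter \<open>Y\<close> flips the Boolean component, while
        \<open>w\<close> leaves it \<open>False\<close>.\<close>
      from word_eq_sim[OF this n, of "(0, False)"] show False
        by (simp add: w qd_sim_def)
    qed
    show "?y \<otimes>\<^bsub>presented_group ?R\<^esub> ?y = \<one>\<^bsub>presented_group ?R\<^esub>"
      by (simp add: presented_group_mult_class one_presented_group rel_y)
    have "inv\<^bsub>presented_group ?R\<^esub> ?y \<otimes>\<^bsub>presented_group ?R\<^esub> ?x \<otimes>\<^bsub>presented_group ?R\<^esub> ?y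
        = ?x [^]\<^bsub>presented_group ?R\<^esub> (2 ^ (n - 2) - 1 :: nat)"
      by (simp add: presented_group_mult_class presented_group_inv_Gen presented_group_pow
          concat_replicate_singleton rel_conj)
    also have "\<dots> = ?x [^]\<^bsub>presented_group ?R\<^esub> int (2 ^ (n - 2) - 1)"
      by (simp only: int_pow_int)
    also have "int (2 ^ (n - 2) - 1) = 2 ^ (n - 2) - 1" by (simp add: of_nat_diff)
    finally show "inv\<^bsub>presented_group ?R\<^esub> ?y \<otimes>\<^bsub>presented_group ?R\<^esub> ?x \<otimes>\<^bsub>presented_group ?R\<^esub> ?y
        = ?x [^]\<^bsub>presented_group ?R\<^esub> (2 ^ (n - 2) - 1 :: int)" .
    have gens: "{?x, ?y} \<subseteq> carrier (presented_group ?R)" using closed by simp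
    have "word_rel ?R `` {[Gen g]} \<in> generate (presented_group ?R) {?x, ?y}" for g
      by (cases g) (auto intro: generate.incl)
    then have "carrier (presented_group ?R) \<subseteq> generate (presented_group ?R) {?x, ?y}"
      by (intro carrier_presented_group_subset generate_is_subgroup gens)
    then show "carrier (presented_group ?R) = generate (presented_group ?R) {?x, ?y}"
      using generate_incl[OF gens] by blast
  qed (auto simp: n closed)
  then show ?thesis by (simp only: quasidihedral_def qd_rel_def)
qed

theorem theorem3p3p8:
  fixes n :: nat
  assumes "n \<ge> 4"
  shows "cdeg (quasidihedral n) = (3 * 2 ^ (n - 3) + real n) / (3 * 2 ^ (n - 2) + real n - 1)"
  using quasidihedral_group.cdeg_eq[OF quasidihedral_group_presented[OF assms]] .

end
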